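(* Let $x=(x_1,x_2,x_3)$, $y=(y_1,y_2,y_3)$ be real variables, and, with indices taken cyclically modulo $3$ (so that $x_4=x_1$ and $y_4=y_1$), let $$f_{sep}(x,y)=\sum_{i=1}^3\left(x_i^4+y_i^4\right),$$ $$B^*(x,y)=\sum_{i=1}^3\Big(2x_i^2y_i^2-2x_i^2y_iy_{i+1}-2x_ix_{i+1}y_i^2+3x_i^2y_{i+1}^2+3x_{i+1}^2y_i^2\Big).$$ Then the polynomial $f(x,y)=f_{sep}(x,y)+0.1\,B^*(x,y)$ is convex on $\mathbb{R}^6$. *)

theory Defs
  imports "HOL-Analysis.Analysis"
begin

text \<open>
  The index type \<^typ>\<open>3\<close> has arithmetic modulo 3 (in it \<open>3 = 0\<close> and \<open>4 = 1\<close>), so \<open>i + 1\<close> is the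
  cyclic successor. A point of 6-dimensional real space is a pair \<open>(x, y)\<close> with the componentwise
  vector space structure.
\<close>

definition f_sep :: "(real ^ 3) \<times> (real ^ 3) \<Rightarrow> real" where
  "f_sep = (\<lambda>(x, y). \<Sum>i\<in>(UNIV :: 3 set). (x $ i) ^ 4 + (y $ i) ^ 4)"

definition B_star :: "(real ^ 3) \<times> (real ^ 3) \<Rightarrow> real" where
  "B_star = (\<lambda>(x, y). \<Sum>i\<in>(UNIV :: 3 set).
      2 * (x $ i)\<^sup>2 * (y $ i)\<^sup>2
    - 2 * (x $ i)\<^sup>2 * (y $ i) * (y $ (i + 1))
    - 2 * (x $ i) * (x $ (i + 1)) * (y $ i)\<^sup>2
    + 3 * (x $ i)\<^sup>2 * (y $ (i + 1))\<^sup>2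
    + 3 * (x $ (i + 1))\<^sup>2 * (y $ i)\<^sup>2)"

end

theory Submission
  imports Defs
begin

text \<open>
  Convexity is checked along lines: the second derivative of \<open>f\<close> at \<open>(x, y)\<close> in a direction
  \<open>(u, v)\<close> has to be nonnegative. It is a sum of three \<^emph>\<open>cells\<close>, where the cell of the index \<open>i\<close>
  involves only the coordinates with indices \<open>i\<close> and \<open>j = i + 1\<close>. A single cell may be negative,
  but it is bounded below by \<open>1/5 (H i - H j)\<close> for the potential
  \<open>H i = 1/5 (x\<^sub>i\<^sup>2 v\<^sub>i\<^sup>2 + u\<^sub>i\<^sup>2 y\<^sub>i\<^sup>2) + 9/2 (x\<^sub>i\<^sup>2 u\<^sub>i\<^sup>2 + y\<^sub>i\<^sup>2 v\<^sub>i\<^sup>2)\<close>,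
  and these differences cancel around the cycle.

  The part of a cell that involves the products \<open>x\<^sub>k v\<^sub>l\<close> and \<open>u\<^sub>k y\<^sub>l\<close> is an indefinite form
  (\<open>mixed_form\<close> below). A larger coefficient of \<open>x\<^sub>i\<^sup>2 v\<^sub>i\<^sup>2\<close> or of \<open>u\<^sub>i\<^sup>2 y\<^sub>i\<^sup>2\<close> helps to repair it,
  but the large squares \<open>x\<^sub>i\<^sup>2 u\<^sub>i\<^sup>2\<close> and \<open>y\<^sub>i\<^sup>2 v\<^sub>i\<^sup>2\<close> contributed by \<open>f_sep\<close> involve other products.
  A case distinction makes them available. If \<open>x\<^sub>i\<^sup>2 \<le> y\<^sub>i\<^sup>2\<close>, then
  \<open>y\<^sub>i\<^sup>2 v\<^sub>i\<^sup>2 \<ge> x\<^sub>i\<^sup>2 v\<^sub>i\<^sup>2\<close>, and otherwise \<open>x\<^sub>i\<^sup>2 u\<^sub>i\<^sup>2 \<ge> u\<^sub>i\<^sup>2 y\<^sub>i\<^sup>2\<close>. In either case one of the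
  two scarce squares becomes abundant. After adding a multiple of the vanishing expression
  \<open>(x\<^sub>i v\<^sub>j) (x\<^sub>j v\<^sub>i) - (x\<^sub>i v\<^sub>i) (x\<^sub>j v\<^sub>j)\<close> or of its analogue for \<open>u\<close> and \<open>y\<close>, an explicit
  sum of squares (lemma \<open>mixed_form_shifted_nonneg\<close>) finishes the cell. The two cases are exchanged
  by the symmetry swapping \<open>(x, u)\<close> with \<open>(y, v)\<close>, which takes \<open>x\<^sub>k v\<^sub>l\<close> to \<open>u\<^sub>l y\<^sub>k\<close>.
\<close>

text \<open>
  The intended arguments are \<open>a = x\<^sub>i v\<^sub>i\<close>, \<open>b = x\<^sub>i v\<^sub>j\<close>, \<open>e = x\<^sub>j v\<^sub>i\<close> and
  \<open>a' = u\<^sub>i y\<^sub>i\<close>, \<open>b' = u\<^sub>i y\<^sub>j\<close>, \<open>e' = u\<^sub>j y\<^sub>i\<close>. Since \<open>a a' = (x\<^sub>i u\<^sub>i) (y\<^sub>i v\<^sub>i)\<close>,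
  \<open>b b' = (x\<^sub>i u\<^sub>i) (y\<^sub>j v\<^sub>j)\<close> and \<open>e e' = (x\<^sub>j u\<^sub>j) (y\<^sub>i v\<^sub>i)\<close>, the last three terms can be traded
  against products of the large quantities; the coefficient 3 is the share of them that is kept here.
\<close>

definition mixed_form :: "real \<Rightarrow> real \<Rightarrow> real \<Rightarrow> real \<Rightarrow> real \<Rightarrow> real \<Rightarrow> real" where
  "mixed_form a b e a' b' e' =
      2 * a\<^sup>2 - 2 * a * (b + e) + 3 * b\<^sup>2 + 3 * e\<^sup>2
    + 2 * a'\<^sup>2 - 2 * a' * (b' + e') + 3 * b'\<^sup>2 + 3 * e'\<^sup>2
    - 4 * a' * (b + e) - 4 * a * (b' + e')
    + 3 * (a * a' + b * b' + e * e')"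

lemma mixed_form_swap: "mixed_form a' b' e' a b e = mixed_form a b e a' b' e'"
  by (simp add: mixed_form_def algebra_simps)

text \<open>
  In terms of \<open>b + e\<close>, \<open>b' + e'\<close> and \<open>b - e\<close>, \<open>b' - e'\<close> the form splits into two independent parts.
  The term \<open>4 b e\<close> strengthens \<open>(b + e)\<^sup>2\<close>, where \<open>mixed_form\<close> is too weak, at the expense of
  \<open>(b - e)\<^sup>2\<close>, where it has room; it is compensated by \<open>- 4 a f\<close>, which only costs \<open>20 a\<^sup>2\<close> besides
  \<open>1/5 f\<^sup>2\<close>. The squares below arise by completing the square in \<open>f\<close>, \<open>b + e\<close>, \<open>a'\<close>, \<open>b' + e'\<close>, and
  in \<open>b - e\<close>.
\<close>

lemma mixed_form_shifted_nonneg: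
  "0 \<le> mixed_form a b e a' b' e' + 40 * a\<^sup>2 + 4 * (b * e - a * f) - 1/5 * (a\<^sup>2 + a'\<^sup>2 - f\<^sup>2)"
proof -
  have "mixed_form a b e a' b' e' + 40 * a\<^sup>2 + 4 * (b * e - a * f) - 1/5 * (a\<^sup>2 + a'\<^sup>2 - f\<^sup>2)
    = 1/5 * (f - 10 * a)\<^sup>2
      + 5/2 * ((b + e) - 2/5 * a - 4/5 * a' + 3/10 * (b' + e'))\<^sup>2
      + 1/5 * (a' + 7/2 * a - 2 * (b' + e'))\<^sup>2
      + 3/10 * ((b' + e') - a)\<^sup>2 + 7/40 * (b' + e')\<^sup>2 + 373/20 * a\<^sup>2
      + 1/2 * ((b - e) + 3/2 * (b' - e'))\<^sup>2 + 3/8 * (b' - e')\<^sup>2"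
    by (simp add: mixed_form_def power2_eq_square field_simps)
  also have "0 \<le> \<dots>"
    by (intro add_nonneg_nonneg mult_nonneg_nonneg) auto
  finally show ?thesis .
qed

text \<open>
  For the products \<open>a = x\<^sub>i v\<^sub>i\<close>, \<open>f = x\<^sub>j v\<^sub>j\<close> the hypothesis \<open>a f = b e\<close> is an identity. It makes the
  compensation in the preceding lemma vanish.
\<close>

lemma mixed_form_lower_bound:
  assumes "a * f = b * e" and "a\<^sup>2 \<le> q\<^sup>2"
  shows "1/5 * (a\<^sup>2 + a'\<^sup>2 - f\<^sup>2) - 40 * q\<^sup>2 \<le> mixed_form a b e a' b' e'"
  using mixed_form_shifted_nonneg[of a b e a' b' e' f] assms by argo

text \<open>
  The primed arguments are the coordinates with the successor index, and \<open>(u, v)\<close> is the direction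
  of differentiation.
\<close>

definition cell :: "real \<Rightarrow> real \<Rightarrow> real \<Rightarrow> real \<Rightarrow> real" where
  "cell x x' y y' = x ^ 4 + y ^ 4 + 1/10 *
    (2 * x\<^sup>2 * y\<^sup>2 - 2 * x\<^sup>2 * y * y' - 2 * x * x' * y\<^sup>2 + 3 * x\<^sup>2 * y'\<^sup>2 + 3 * x'\<^sup>2 * y\<^sup>2)"

definition cell_deriv ::
  "real \<Rightarrow> real \<Rightarrow> real \<Rightarrow> real \<Rightarrow> real \<Rightarrow> real \<Rightarrow> real \<Rightarrow> real \<Rightarrow> real" where
  "cell_deriv x x' y y' u u' v v' = 4 * x ^ 3 * u + 4 * y ^ 3 * v + 1/10 *
    (4 * x * u * y\<^sup>2 + 4 * x\<^sup>2 * y * v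
     - 4 * x * u * y * y' - 2 * x\<^sup>2 * v * y' - 2 * x\<^sup>2 * y * v'
     - 2 * u * x' * y\<^sup>2 - 2 * x * u' * y\<^sup>2 - 4 * x * x' * y * v
     + 6 * x * u * y'\<^sup>2 + 6 * x\<^sup>2 * y' * v' + 6 * x' * u' * y\<^sup>2 + 6 * x'\<^sup>2 * y * v)"

text \<open>
  The second derivative of a cell in the direction \<open>(u, v)\<close>, scaled as \<open>1/5\<close> so that the coefficients
  are integers. The products \<open>(x u) (y v)\<close> and \<open>(x u) (y' v')\<close>, \<open>(x' u') (y v)\<close> occur in it
  with coefficients 8 and 12, of which \<open>mixed_form\<close> accounts for 3.
\<close>

definition cell_hess ::
  "real \<Rightarrow> real \<Rightarrow> real \<Rightarrow> real \<Rightarrow> real \<Rightarrow> real \<Rightarrow> real \<Rightarrow> real \<Rightarrow> real" where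
  "cell_hess x x' y y' u u' v v' = 1/5 *
    (60 * ((x * u)\<^sup>2 + (y * v)\<^sup>2)
     + 5 * (x * u) * (y * v) + 9 * ((x * u) * (y' * v') + (x' * u') * (y * v))
     + mixed_form (x * v) (x * v') (x' * v) (u * y) (u * y') (u' * y))"

lemma has_derivative_cell:
  "((\<lambda>t. cell (x + t * u) (x' + t * u') (y + t * v) (y' + t * v')) has_real_derivative
     cell_deriv (x + t * u) (x' + t * u') (y + t * v) (y' + t * v') u u' v v') (at t)"
  unfolding cell_def cell_deriv_def
  by (rule derivative_eq_intros refl)+ (simp add: algebra_simps power2_eq_square power3_eq_cube)

lemma has_derivative_cell_deriv:
  "((\<lambda>t. cell_deriv (x + t * u) (x' + t * u') (y + t * v) (y' + t * v') u u' v v') has_real_derivative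
     cell_hess (x + t * u) (x' + t * u') (y + t * v) (y' + t * v') u u' v v') (at t)"
proof -
  define X X' Y Y' where X: "X = x + t * u" and X': "X' = x' + t * u'"
    and Y: "Y = y + t * v" and Y': "Y' = y' + t * v'"
  show ?thesis
    unfolding cell_hess_def mixed_form_def cell_deriv_def
    by (rule derivative_eq_intros refl)+
       (simp flip: X X' Y Y', simp add: field_simps power2_eq_square)
qed

definition potential :: "real \<Rightarrow> real \<Rightarrow> real \<Rightarrow> real \<Rightarrow> real" where
  "potential x y u v = 1/5 * ((x * v)\<^sup>2 + (u * y)\<^sup>2) + 9/2 * ((x * u)\<^sup>2 + (y * v)\<^sup>2)"

text \<open>
  Of the coefficient 60 of the squares \<open>(x u)\<^sup>2\<close> and \<open>(y v)\<^sup>2\<close>, 40 is spent on \<open>mixed_form\<close>, and the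
  rest dominates the products \<open>(x u) (y v)\<close>, \<open>(x u) (y' v')\<close>, \<open>(x' u') (y v)\<close>. The squares of
  \<open>x' u'\<close>, \<open>y' v'\<close>, \<open>x' v'\<close>, \<open>u' y'\<close> used for this belong to the next cell, hence the difference
  of potentials.
\<close>

lemma cell_hess_lower_bound:
  "1/5 * (potential x y u v - potential x' y' u' v') \<le> cell_hess x x' y y' u u' v v'"
proof -
  define M where "M = mixed_form (x * v) (x * v') (x' * v) (u * y) (u * y') (u' * y)"
  have M: "1/5 * ((x * v)\<^sup>2 + (u * y)\<^sup>2 - (x' * v')\<^sup>2 - (u' * y')\<^sup>2)
             - 40 * ((x * u)\<^sup>2 + (y * v)\<^sup>2) \<le> M"
  proof (cases "x\<^sup>2 \<le> y\<^sup>2")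
    case True
    then have "(x * v)\<^sup>2 \<le> (y * v)\<^sup>2"
      by (simp add: power_mult_distrib mult_right_mono)
    then have "1/5 * ((x * v)\<^sup>2 + (u * y)\<^sup>2 - (x' * v')\<^sup>2) - 40 * (y * v)\<^sup>2 \<le> M"
      unfolding M_def by (intro mixed_form_lower_bound) auto
    moreover have "0 \<le> (u' * y')\<^sup>2" "0 \<le> (x * u)\<^sup>2"
      by simp_all
    ultimately show ?thesis
      by argo
  next
    case False
    then have "(u * y)\<^sup>2 \<le> (x * u)\<^sup>2"
      by (simp add: power_mult_distrib mult_left_mono mult.commute[of _ "u\<^sup>2"])
    then have "1/5 * ((u * y)\<^sup>2 + (x * v)\<^sup>2 - (u' * y')\<^sup>2) - 40 * (x * u)\<^sup>2 \<le> M"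
      unfolding M_def by (subst mixed_form_swap[symmetric], intro mixed_form_lower_bound) auto
    moreover have "0 \<le> (x' * v')\<^sup>2" "0 \<le> (y * v)\<^sup>2"
      by simp_all
    ultimately show ?thesis
      by argo
  qed
  have amgm: "- (s\<^sup>2 + t\<^sup>2) \<le> 2 * (s * t)" for s t :: real
    using zero_le_power2[of "s + t"] by (simp add: power2_sum)
  have "0 \<le> (x * u)\<^sup>2" "0 \<le> (y * v)\<^sup>2"
    by simp_all
  then show ?thesis
    using M amgm[of "x * u" "y * v"] amgm[of "x * u" "y' * v'"] amgm[of "x' * u'" "y * v"]
    unfolding cell_hess_def potential_def M_def[symmetric] mult.assoc[of 5] by argo
qed

lemma convex_on_UNIV_if_convex_on_lines:
  fixes F :: "'a::real_vector \<Rightarrow> real"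
  assumes "\<And>z h. convex_on UNIV (\<lambda>t. F (z + t *\<^sub>R h))"
  shows "convex_on UNIV F"
proof (rule convex_onI)
  fix t :: real and z w :: 'a
  assume "0 < t" "t < 1"
  then have "F (z + ((1 - t) *\<^sub>R 0 + t *\<^sub>R 1) *\<^sub>R (w - z))
      \<le> (1 - t) * F (z + 0 *\<^sub>R (w - z)) + t * F (z + 1 *\<^sub>R (w - z))"
    using convex_onD[OF assms[of z "w - z"], of t 0 1] by simp
  then show "F ((1 - t) *\<^sub>R z + t *\<^sub>R w) \<le> (1 - t) * F z + t * F w"
    by (simp add: algebra_simps)
qed simp

lemma sum_shift_3: "(\<Sum>i\<in>UNIV. g (i + 1)) = (\<Sum>i\<in>UNIV. g i)" for g :: "3 \<Rightarrow> real"
  by (rule sum.reindex_bij_witness[where i = "\<lambda>i. i - 1" and j = "\<lambda>i. i + 1"]) auto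

lemma convex_on_cells_line:
  fixes x y u v :: "3 \<Rightarrow> real"
  shows "convex_on UNIV (\<lambda>t. \<Sum>i\<in>UNIV.
    cell (x i + t * u i) (x (i + 1) + t * u (i + 1)) (y i + t * v i) (y (i + 1) + t * v (i + 1)))"
proof (rule f''_ge0_imp_convex)
  let ?H = "\<lambda>t i. potential (x i + t * u i) (y i + t * v i) (u i) (v i)"
  fix t :: real
  have "0 = (\<Sum>i\<in>UNIV. 1/5 * (?H t i - ?H t (i + 1)))"
    using sum_shift_3[of "?H t"] by (simp add: sum_subtractf flip: sum_divide_distrib)
  also have "\<dots> \<le> (\<Sum>i\<in>UNIV. cell_hess (x i + t * u i) (x (i + 1) + t * u (i + 1))
      (y i + t * v i) (y (i + 1) + t * v (i + 1)) (u i) (u (i + 1)) (v i) (v (i + 1)))"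
    by (intro sum_mono cell_hess_lower_bound)
  finally show "0 \<le> \<dots>" .
qed (auto intro!: DERIV_sum has_derivative_cell has_derivative_cell_deriv)

theorem theorem3p1:
  shows "convex_on (UNIV :: ((real ^ 3) \<times> (real ^ 3)) set) (\<lambda>z. f_sep z + 1 / 10 * B_star z)"
proof (rule convex_on_UNIV_if_convex_on_lines)
  fix z h :: "(real ^ 3) \<times> (real ^ 3)"
  have "f_sep w + 1 / 10 * B_star w =
      (\<Sum>i\<in>UNIV. cell (fst w $ i) (fst w $ (i + 1)) (snd w $ i) (snd w $ (i + 1)))" for w
    by (simp add: f_sep_def B_star_def cell_def case_prod_beta sum.distrib flip: sum_divide_distrib)
  then show "convex_on UNIV (\<lambda>t. f_sep (z + t *\<^sub>R h) + 1 / 10 * B_star (z + t *\<^sub>R h))"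
    using convex_on_cells_line[of "($) (fst z)" "($) (fst h)" "($) (snd z)" "($) (snd h)"] by simp
qed

end
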